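(* Let $\mathcal{A}\in\mathbb{R}^{n\times n}$ be a $P$-matrix, let $\sigma\in\mathbb{R}^n$, and let $\mathcal{A}=(\mathcal{M}+I+D_{\mathcal{A}})-(\mathcal{N}+I+D_{\mathcal{A}})$ be a splitting of $\mathcal{A}$ with $\mathcal{M},\mathcal{N}\in\mathbb{R}^{n\times n}$ such that $\mathcal{M}+2I+D_{\mathcal{A}}$ is nonsingular. Let $\zeta_+^{*}\in\mathbb{R}^n$ be the solution of the fixed point equation $$\zeta_{+}=(\mathcal{M}+2I+D_{\mathcal{A}})^{-1}\big[(\mathcal{N}+I+D_{\mathcal{A}})\zeta_{+}+|(\mathcal{A}-I)\zeta_{+}+\sigma|-\sigma\big].$$ Suppose that $$\rho\Big(|(\mathcal{M}+2I+D_{\mathcal{A}})^{-1}|\,\big(|\mathcal{N}+I+D_{\mathcal{A}}|+|\mathcal{A}-I|\big)\Big)<1 .$$ Then for any initial vector $\zeta^{(0)}\in\mathbb{R}^n$, the sequence $\{\zeta_+^{(\eta)}\}_{\eta=1}^{+\infty}$ generated from $\zeta_+^{(0)}=\max\{0,\zeta^{(0)}\}$ by $$\zeta^{(\eta+1)}_{+}=(\mathcal{M}+2I+D_{\mathcal{A}})^{-1}\big[(\mathcal{N}+I+D_{\mathcal{A}})\zeta^{(\eta)}_{+}+|(\mathcal{A}-I)\zeta^{(\eta)}_{+}+\sigma|-\sigma\big],\qquad \eta=0,1,2,\ldots,$$ converges to $\zeta_+^{*}$.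
   Context: $I$ is the $n\times n$ identity matrix and $D_{\mathcal{A}}$ is the diagonal matrix with the same diagonal as $\mathcal{A}$. For a vector or matrix, $|\cdot|$ denotes the entrywise absolute value, and $\max\{0,\zeta\}$ of a vector is taken entrywise. $\rho$ denotes the spectral radius. A real square matrix is a $P$-matrix if all its principal minors are positive. In the iteration, $\zeta_+^{(\eta+1)}$ is simply the name of the vector given by the right-hand side (no further positive part is taken for $\eta\ge 0$). *)

theory Defs
  imports "HOL-Analysis.Analysis"
begin

text \<open>The principal minor of \<open>A\<close> on the index set \<open>S\<close>: the determinant (Leibniz formula, as in the
  library's \<^const>\<open>det\<close>) of the submatrix of \<open>A\<close> with rows and columns in \<open>S\<close>.
  For \<open>S = UNIV\<close> it is \<open>det A\<close>.\<close>

definition principal_minor :: "real ^ 'n ^ 'n \<Rightarrow> 'n set \<Rightarrow> real" where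
  "principal_minor A S = (\<Sum>p | p permutes S. of_int (sign p) * (\<Prod>i\<in>S. A $ i $ p i))"

definition P_matrix :: "real ^ 'n ^ 'n \<Rightarrow> bool" where
  "P_matrix A \<longleftrightarrow> (\<forall>S. S \<noteq> {} \<longrightarrow> principal_minor A S > 0)"

definition diag_part :: "real ^ 'n ^ 'n \<Rightarrow> real ^ 'n ^ 'n" where
  "diag_part A = (\<chi> i j. if i = j then A $ i $ j else 0)"

definition eigenvalues :: "complex ^ 'n ^ 'n \<Rightarrow> complex set" where
  "eigenvalues A = {k. \<exists>v. v \<noteq> 0 \<and> A *v v = k *s v}"

text \<open>Complex eigenvalues of a real matrix count. Their set is finite and nonempty, so the
  maximum is attained.\<close>

definition spectral_radius :: "real ^ 'n ^ 'n \<Rightarrow> real" where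
  "spectral_radius A = Max (cmod ` eigenvalues (map_matrix complex_of_real A))"

text \<open>On vectors and on matrices, the library's \<open>\<bar>_\<bar>\<close> (class \<^class>\<open>ordered_euclidean_space\<close>) is
  the entrywise absolute value:\<close>

lemma abs_vec_nth: "\<bar>x :: real ^ 'n\<bar> $ i = \<bar>x $ i\<bar>"
  by (simp add: abs_vec_def)

lemma abs_matrix_nth: "\<bar>A :: real ^ 'n ^ 'm\<bar> $ i $ j = \<bar>A $ i $ j\<bar>"
  by (simp add: abs_vec_def)

end

theory Submission
  imports Defs "HOL-Computational_Algebra.Fundamental_Theorem_Algebra"
begin

text \<open>
  Write \<open>T\<close> for the nonnegative matrix whose spectral radius is assumed to be below \<open>1\<close>. Subtracting
  the fixed point equation from the recurrence removes \<open>\<sigma>\<close>, and since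
  \<open>\<bar>\<bar>u\<bar> - \<bar>v\<bar>\<bar> \<le> \<bar>u - v\<bar>\<close> entrywise, the errors satisfy
  \<open>\<bar>\<zeta> (Suc k) - \<zeta>star\<bar> \<le> T *v \<bar>\<zeta> k - \<zeta>star\<bar>\<close>. As \<open>T\<close> preserves the entrywise order, the \<open>k\<close>-th error
  is at most \<open>T\<^sup>k\<close> applied to the initial error, and it remains to see that \<open>T\<^sup>k x \<longlonglongrightarrow> 0\<close> for
  every \<open>x\<close>.

  That powers of a complex matrix \<open>B\<close> tend to \<open>0\<close> when all eigenvalues lie in the open unit disc is
  obtained here from the minimal polynomial of \<open>B\<close>, without a normal form. Its roots are exactly the
  eigenvalues (\<open>minimal_polynomial_exists\<close>). Let \<open>S\<close> be the set of vectors \<open>w\<close> with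
  \<open>B\<^sup>k w \<longlonglongrightarrow> 0\<close>. If \<open>cmod l < 1\<close> and \<open>B w - l w\<close> is in \<open>S\<close>, then so is \<open>w\<close>,
  because \<open>x\<^sub>k = B\<^sup>k w\<close> solves the scalar recurrence \<open>x\<^bsub>k+1\<^esub> = l x\<^sub>k + y\<^sub>k\<close> with \<open>y\<^sub>k \<longlonglongrightarrow> 0\<close>
  (\<open>stable_if_shift_stable\<close>). The minimal polynomial sends every vector to \<open>0\<close>, which is in \<open>S\<close>;
  cancelling its linear factors one at a time puts every vector in \<open>S\<close>.
\<close>

section \<open>Polynomials acting on vectors through a matrix\<close>

text \<open>The vector \<open>p(B) v\<close>, by Horner's scheme; this avoids a separate theory of matrix powers.\<close>

definition poly_action :: "complex ^ 'n ^ 'n \<Rightarrow> complex poly \<Rightarrow> complex ^ 'n \<Rightarrow> complex ^ 'n" where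
  "poly_action B p v = fold_coeffs (\<lambda>a w. a *s v + B *v w) p 0"

lemma poly_action_0 [simp]: "poly_action B 0 v = 0"
  by (simp add: poly_action_def)

lemma poly_action_pCons [simp]: "poly_action B (pCons a p) v = a *s v + B *v poly_action B p v"
  by (cases "a = 0 \<and> p = 0") (auto simp: poly_action_def)

lemma poly_action_add: "poly_action B (p + q) v = poly_action B p v + poly_action B q v"
  by (induction p q rule: poly_induct2)
     (simp_all add: vector_sadd_rdistrib matrix_vector_right_distrib)

lemma poly_action_smult: "poly_action B (smult c p) v = c *s poly_action B p v"
  by (induction p) (simp_all add: vector_add_ldistrib vector_scalar_commute vector_smult_assoc)

lemma poly_action_monom: "poly_action B (monom c k) v = c *s ((*v) B ^^ k) v"
  by (induction k) (simp_all add: monom_0 monom_Suc vector_scalar_commute)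

lemma poly_action_sum: "poly_action B (sum f I) v = (\<Sum>i\<in>I. poly_action B (f i) v)"
  by (induction I rule: infinite_finite_induct) (simp_all add: poly_action_add)

lemma poly_action_linear_factor:
  "poly_action B ([:- l, 1:] * q) v = B *v poly_action B q v - l *s poly_action B q v"
proof -
  have "poly_action B ([:- l, 1:] * q) v = poly_action B (smult (- l) q + pCons 0 q) v"
    by simp
  then show ?thesis
    by (simp only: poly_action_add poly_action_smult poly_action_pCons) simp
qed

lemma poly_action_eigenvector:
  assumes "B *v v = l *s v"
  shows "poly_action B p v = poly p l *s v"
  by (induction p)
     (simp_all add: assms vector_scalar_commute vector_smult_assoc vector_sadd_rdistrib mult.commute)

section \<open>The minimal polynomial and the eigenvalues\<close>

text \<open>The matrices form a real vector space of finite dimension, so finitely many powers of \<open>B\<close>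
  already satisfy a linear relation, whose coefficients can even be taken real.\<close>

lemma annihilating_polynomial_exists:
  fixes B :: "complex ^ 'n ^ 'n"
  obtains p where "p \<noteq> 0" and "\<And>v. poly_action B p v = 0"
proof -
  define pow :: "nat \<Rightarrow> complex ^ 'n ^ 'n" where "pow = (\<lambda>k. ((**) B ^^ k) (mat 1))"
  define m where "m = DIM(complex ^ 'n ^ 'n)"
  have pow_apply: "pow k *v v = ((*v) B ^^ k) v" for k v
    by (induction k) (simp_all add: pow_def flip: matrix_vector_mul_assoc)
  obtain c :: "nat \<Rightarrow> real"
    where nonzero: "\<exists>k\<le>m. c k \<noteq> 0" and relation: "(\<Sum>k\<le>m. c k *\<^sub>R pow k) = 0"
  proof (cases "inj_on pow {..m}")
    case True
    then have "card (pow ` {..m}) > DIM(complex ^ 'n ^ 'n)"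
      by (simp add: card_image m_def)
    then have "dependent (pow ` {..m})"
      by (intro dependent_biggerset) auto
    then obtain u where "\<exists>X\<in>pow ` {..m}. u X \<noteq> 0" and "(\<Sum>X\<in>pow ` {..m}. u X *\<^sub>R X) = 0"
      by (auto simp: dependent_finite)
    then show ?thesis
      using True that[of "u \<circ> pow"] by (auto simp: sum.reindex)
  next
    \<comment> \<open>A repeated power is a relation by itself.\<close>
    case False
    then obtain i j where ij: "i \<le> m" "j \<le> m" "i \<noteq> j" "pow i = pow j"
      by (auto simp: inj_on_def)
    define c :: "nat \<Rightarrow> real" where "c = (\<lambda>k. if k = i then 1 else if k = j then - 1 else 0)"
    have "(\<Sum>k\<le>m. c k *\<^sub>R pow k) = (\<Sum>k\<in>{i, j}. c k *\<^sub>R pow k)"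
      using ij by (intro sum.mono_neutral_right) (auto simp: c_def)
    also have "\<dots> = 0"
      using ij by (simp add: c_def)
    finally have "(\<Sum>k\<le>m. c k *\<^sub>R pow k) = 0" .
    moreover have "c i \<noteq> 0"
      by (simp add: c_def)
    ultimately show ?thesis
      using that[of c] ij(1) by blast
  qed
  define p where "p = (\<Sum>k\<le>m. monom (complex_of_real (c k)) k)"
  have "coeff p k = complex_of_real (c k)" if "k \<le> m" for k
    using that by (simp add: p_def coeff_sum)
  with nonzero have "p \<noteq> 0"
    by (metis coeff_0 of_real_eq_0_iff)
  moreover have "poly_action B p v = 0" for v
  proof -
    have "poly_action B p v = (\<Sum>k\<le>m. complex_of_real (c k) *s (pow k *v v))"
      by (simp add: p_def poly_action_sum poly_action_monom pow_apply)
    also have "\<dots> = (\<Sum>k\<le>m. c k *\<^sub>R pow k) *v v"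
    proof -
      have "complex_of_real r *s (X *v v) = (r *\<^sub>R X) *v v" for r and X :: "complex ^ 'n ^ 'n"
        by (simp add: vec_eq_iff matrix_vector_mult_def sum_distrib_left
            scaleR_conv_of_real[where 'a = complex] mult.assoc)
      moreover have "(\<Sum>k\<in>I. F k *v v) = (\<Sum>k\<in>I. F k) *v v"
        for F :: "nat \<Rightarrow> complex ^ 'n ^ 'n" and I
        by (induction I rule: infinite_finite_induct)
           (simp_all add: matrix_vector_mult_add_rdistrib)
      ultimately show ?thesis
        by simp
    qed
    finally show ?thesis
      by (simp add: relation)
  qed
  ultimately show ?thesis
    using that by blast
qed

text \<open>A root \<open>l\<close> of the annihilating polynomial of least degree is an eigenvalue: the cofactor \<open>q\<close> of
  the linear factor does not annihilate \<open>B\<close>, and any nonzero vector \<open>q(B) v\<close> is an eigenvector for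
  \<open>l\<close>.\<close>

lemma minimal_polynomial_exists:
  fixes B :: "complex ^ 'n ^ 'n"
  obtains p where "p \<noteq> 0" and "\<And>v. poly_action B p v = 0"
    and "eigenvalues B = {l. poly p l = 0}"
proof -
  define P where "P = (\<lambda>p. p \<noteq> 0 \<and> (\<forall>v. poly_action B p v = 0))"
  have "\<exists>p. P p"
    using annihilating_polynomial_exists[of B] unfolding P_def by metis
  then obtain p where p: "P p" and minimal: "\<And>q. P q \<Longrightarrow> degree p \<le> degree q"
    using ex_has_least_nat[of P _ degree] by blast
  have "poly p l = 0" if "l \<in> eigenvalues B" for l
    using that p by (auto simp: eigenvalues_def P_def) (metis poly_action_eigenvector vector_mul_eq_0)
  moreover have "l \<in> eigenvalues B" if "poly p l = 0" for l
  proof -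
    from that obtain q where q: "p = [:- l, 1:] * q"
      by (auto simp: poly_eq_0_iff_dvd elim: dvdE)
    with p have "q \<noteq> 0"
      by (auto simp: P_def)
    then have "degree q < degree p"
      unfolding q by (subst degree_mult_eq) auto
    with minimal[of q] \<open>q \<noteq> 0\<close> obtain v where v: "poly_action B q v \<noteq> 0"
      by (auto simp: P_def)
    have "poly_action B p v = 0"
      using p by (simp add: P_def)
    then have "B *v poly_action B q v = l *s poly_action B q v"
      unfolding q poly_action_linear_factor by simp
    with v show ?thesis
      by (auto simp: eigenvalues_def)
  qed
  ultimately show ?thesis
    using that[of p] p by (auto simp: P_def)
qed

lemma finite_eigenvalues:
  fixes B :: "complex ^ 'n ^ 'n"
  shows "finite (eigenvalues B)"
proof -
  obtain p where "p \<noteq> 0" "eigenvalues B = {l. poly p l = 0}"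
    by (rule minimal_polynomial_exists[of B])
  then show ?thesis
    by (simp add: poly_roots_finite)
qed

section \<open>Matrices with all eigenvalues in the open unit disc\<close>

text \<open>The value \<open>e\<close> is the fixed point of \<open>t \<mapsto> r t + e (1 - r)\<close>. So once \<open>b\<close> stays below
  \<open>e (1 - r)\<close>, the amount by which \<open>a\<close> can exceed \<open>e\<close> shrinks by the factor \<open>r\<close> in each step.\<close>

lemma contractive_recurrence_tendsto_0:
  fixes a b :: "nat \<Rightarrow> real"
  assumes nonneg: "\<And>k. 0 \<le> a k"
    and step: "\<And>k. a (Suc k) \<le> r * a k + b k"
    and r: "0 \<le> r" "r < 1"
    and b: "b \<longlonglongrightarrow> 0"
  shows "a \<longlonglongrightarrow> 0"
proof (rule LIMSEQ_I)
  fix d :: real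
  assume "0 < d"
  define e where "e = d / 2"
  have "0 < e"
    using \<open>0 < d\<close> by (simp add: e_def)
  then have "0 < e * (1 - r)"
    using r by simp
  with b obtain K where K: "\<And>k. k \<ge> K \<Longrightarrow> b k < e * (1 - r)"
    using LIMSEQ_D[OF b, of "e * (1 - r)"] by fastforce
  have excess: "a (K + j) \<le> e + r ^ j * a K" for j
  proof (induction j)
    case 0
    then show ?case
      using \<open>0 < e\<close> by simp
  next
    case (Suc j)
    have "a (Suc (K + j)) \<le> r * a (K + j) + e * (1 - r)"
      using step[of "K + j"] K[of "K + j"] by simp
    also have "\<dots> \<le> r * (e + r ^ j * a K) + e * (1 - r)"
      using Suc r by (simp add: mult_left_mono)
    finally show ?case
      by (simp add: algebra_simps)
  qed
  have "(\<lambda>j. r ^ j * a K) \<longlonglongrightarrow> 0"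
    using r by (intro tendsto_mult_left_zero LIMSEQ_power_zero) simp
  then obtain J where J: "\<And>j. j \<ge> J \<Longrightarrow> r ^ j * a K < e"
    using LIMSEQ_D[of _ 0 e] \<open>0 < e\<close> by fastforce
  have "norm (a k - 0) < d" if "k \<ge> K + J" for k
    using excess[of "k - K"] J[of "k - K"] nonneg[of k] that
    by (simp add: e_def le_diff_conv2 add.commute)
  then show "\<exists>k0. \<forall>k\<ge>k0. norm (a k - 0) < d"
    by blast
qed

lemma matrix_iterate_diff:
  fixes B :: "complex ^ 'n ^ 'n"
  shows "((*v) B ^^ k) (x - y) = ((*v) B ^^ k) x - ((*v) B ^^ k) y"
  by (induction k) (simp_all add: matrix_vector_mult_diff_distrib)

lemma matrix_iterate_scale:
  fixes B :: "complex ^ 'n ^ 'n"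
  shows "((*v) B ^^ k) (c *s x) = c *s ((*v) B ^^ k) x"
  by (induction k) (simp_all add: vector_scalar_commute)

text \<open>This is the step that cancels a linear factor: each coordinate of the orbit of \<open>w\<close> solves a scalar recurrence with factor \<open>l\<close>, perturbed by the
  orbit of \<open>B w - l w\<close>.\<close>

lemma stable_if_shift_stable:
  fixes B :: "complex ^ 'n ^ 'n"
  assumes "cmod l < 1"
    and shift: "(\<lambda>k. ((*v) B ^^ k) (B *v w - l *s w)) \<longlonglongrightarrow> 0"
  shows "(\<lambda>k. ((*v) B ^^ k) w) \<longlonglongrightarrow> 0"
proof (rule vec_tendstoI)
  fix i
  define x where "x = (\<lambda>k. ((*v) B ^^ k) w $ i)"
  define y where "y = (\<lambda>k. ((*v) B ^^ k) (B *v w - l *s w) $ i)"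
  have "x (Suc k) = l * x k + y k" for k
    by (simp add: x_def y_def matrix_iterate_diff matrix_iterate_scale funpow_swap1)
  then have step: "cmod (x (Suc k)) \<le> cmod l * cmod (x k) + cmod (y k)" for k
    by (metis norm_mult norm_triangle_ineq)
  have "y \<longlonglongrightarrow> 0"
    using tendsto_vec_nth[OF shift, of i] by (simp add: y_def)
  then have "(\<lambda>k. cmod (y k)) \<longlonglongrightarrow> 0"
    by (rule tendsto_norm_zero)
  then have "(\<lambda>k. cmod (x k)) \<longlonglongrightarrow> 0"
    using contractive_recurrence_tendsto_0[of "\<lambda>k. cmod (x k)" "cmod l" "\<lambda>k. cmod (y k)"]
      step assms(1) by simp
  then show "(\<lambda>k. ((*v) B ^^ k) w $ i) \<longlonglongrightarrow> 0 $ i"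
    by (simp add: x_def tendsto_norm_zero_iff)
qed

lemma stable_if_poly_action_stable:
  fixes B :: "complex ^ 'n ^ 'n"
  assumes "p \<noteq> 0" and "\<And>l. poly p l = 0 \<Longrightarrow> cmod l < 1"
    and "(\<lambda>k. ((*v) B ^^ k) (poly_action B p v)) \<longlonglongrightarrow> 0"
  shows "(\<lambda>k. ((*v) B ^^ k) v) \<longlonglongrightarrow> 0"
  using assms
proof (induction "degree p" arbitrary: p rule: less_induct)
  case (less p)
  show ?case
  proof (cases "degree p = 0")
    case True
    then obtain c where c: "p = [:c:]" "c \<noteq> 0"
      using less.prems(1) by (metis degree_eq_zeroE pCons_0_0)
    have "(\<lambda>k. c *s ((*v) B ^^ k) v) \<longlonglongrightarrow> 0"
      using less.prems(3) by (simp add: c matrix_iterate_scale)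
    then have *: "(\<lambda>k. inverse c * (c *s ((*v) B ^^ k) v) $ i) \<longlonglongrightarrow> inverse c * 0 $ i" for i
      by (intro tendsto_intros)
    show ?thesis
      by (rule vec_tendstoI) (use * c in \<open>simp add: mult.assoc [symmetric]\<close>)
  next
    case False
    then obtain l where l: "poly p l = 0"
      using alg_closed_imp_poly_has_root[of p] by auto
    then obtain q where q: "p = [:- l, 1:] * q"
      by (auto simp: poly_eq_0_iff_dvd elim: dvdE)
    with less.prems(1) have "q \<noteq> 0"
      by auto
    then have "degree q < degree p"
      unfolding q by (subst degree_mult_eq) auto
    moreover have "(\<lambda>k. ((*v) B ^^ k) (poly_action B q v)) \<longlonglongrightarrow> 0"
      using less.prems(2)[OF l] less.prems(3)
      unfolding q poly_action_linear_factor by (rule stable_if_shift_stable)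
    moreover have "cmod z < 1" if "poly q z = 0" for z
      using less.prems(2)[of z] that by (simp add: q)
    ultimately show ?thesis
      using less.hyps \<open>q \<noteq> 0\<close> by blast
  qed
qed

lemma iterates_tendsto_0_if_eigenvalues_less_1:
  fixes B :: "complex ^ 'n ^ 'n"
  assumes "\<And>l. l \<in> eigenvalues B \<Longrightarrow> cmod l < 1"
  shows "(\<lambda>k. ((*v) B ^^ k) v) \<longlonglongrightarrow> 0"
proof -
  obtain p where p: "p \<noteq> 0" "\<And>v. poly_action B p v = 0" "eigenvalues B = {l. poly p l = 0}"
    by (rule minimal_polynomial_exists[of B]) blast
  have "((*v) B ^^ k) 0 = 0" for k
    by (induction k) simp_all
  with p(2) have "(\<lambda>k. ((*v) B ^^ k) (poly_action B p v)) \<longlonglongrightarrow> 0"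
    by simp
  moreover have "cmod l < 1" if "poly p l = 0" for l
    using assms that p(3) by simp
  ultimately show ?thesis
    using p(1) stable_if_poly_action_stable by blast
qed

text \<open>The finiteness of the spectrum is what makes the maximum in \<^const>\<open>spectral_radius\<close> an upper
  bound for the moduli of the eigenvalues.\<close>

lemma iterates_tendsto_0_if_spectral_radius_less_1:
  fixes T :: "real ^ 'n ^ 'n"
  assumes "spectral_radius T < 1"
  shows "(\<lambda>k. ((*v) T ^^ k) x) \<longlonglongrightarrow> 0"
proof (rule vec_tendstoI)
  fix i
  define B where "B = map_matrix complex_of_real T"
  define cvec :: "real ^ 'n \<Rightarrow> complex ^ 'n" where "cvec = (\<lambda>u. \<chi> j. complex_of_real (u $ j))"
  have "B *v cvec u = cvec (T *v u)" for u
    by (simp add: B_def cvec_def vec_eq_iff matrix_vector_mult_def map_matrix_def)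
  then have iterate: "((*v) B ^^ k) (cvec x) = cvec (((*v) T ^^ k) x)" for k
    by (induction k) simp_all
  have "cmod l < 1" if "l \<in> eigenvalues B" for l
  proof -
    have "cmod l \<le> spectral_radius T"
      unfolding spectral_radius_def using that
      by (intro Max_ge finite_imageI finite_eigenvalues) (simp add: B_def)
    with assms show ?thesis
      by simp
  qed
  then have "(\<lambda>k. ((*v) B ^^ k) (cvec x)) \<longlonglongrightarrow> 0"
    by (rule iterates_tendsto_0_if_eigenvalues_less_1)
  then have "(\<lambda>k. ((*v) B ^^ k) (cvec x) $ i) \<longlonglongrightarrow> 0 $ i"
    by (rule tendsto_vec_nth)
  then have "(\<lambda>k. complex_of_real (((*v) T ^^ k) x $ i)) \<longlonglongrightarrow> complex_of_real 0"
    unfolding iterate by (simp add: cvec_def)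
  then show "(\<lambda>k. ((*v) T ^^ k) x $ i) \<longlonglongrightarrow> 0 $ i"
    unfolding tendsto_of_real_iff by simp
qed

section \<open>Entrywise error bounds\<close>

lemma abs_matrix_vector_mult_le:
  fixes C :: "real ^ 'n ^ 'm"
  shows "\<bar>C *v x\<bar> \<le> \<bar>C\<bar> *v \<bar>x\<bar>"
  by (auto simp: less_eq_vec_def matrix_vector_mult_def abs_vec_nth abs_matrix_nth
           simp flip: abs_mult intro!: sum_abs)

lemma nonneg_matrix_vector_mult_mono:
  fixes C :: "real ^ 'n ^ 'm"
  assumes "0 \<le> C" and "x \<le> y"
  shows "C *v x \<le> C *v y"
  using assms by (auto simp: less_eq_vec_def matrix_vector_mult_def intro!: sum_mono mult_left_mono)

lemma dominated_by_iterates_tendsto_0: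
  fixes T :: "real ^ 'n ^ 'n" and e :: "nat \<Rightarrow> real ^ 'n"
  assumes "0 \<le> T" and "spectral_radius T < 1"
    and step: "\<And>k. \<bar>e (Suc k)\<bar> \<le> T *v \<bar>e k\<bar>"
  shows "e \<longlonglongrightarrow> 0"
proof (rule vec_tendstoI)
  fix i
  have "\<bar>e k\<bar> \<le> ((*v) T ^^ k) \<bar>e 0\<bar>" for k
  proof (induction k)
    case (Suc k)
    then show ?case
      using step[of k] nonneg_matrix_vector_mult_mono[OF assms(1) Suc] by simp
  qed simp
  then have "norm (e k $ i) \<le> ((*v) T ^^ k) \<bar>e 0\<bar> $ i" for k
    by (simp add: less_eq_vec_def abs_vec_nth)
  moreover have "(\<lambda>k. ((*v) T ^^ k) \<bar>e 0\<bar> $ i) \<longlonglongrightarrow> 0"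
    using tendsto_vec_nth[OF iterates_tendsto_0_if_spectral_radius_less_1[OF assms(2)]] by simp
  ultimately show "(\<lambda>k. e k $ i) \<longlonglongrightarrow> 0 $ i"
    by (metis (no_types, lifting) Lim_null_comparison always_eventually zero_index)
qed

text \<open>The term \<open>- s\<close> cancels in the difference of the arguments of \<open>G\<close>, and the shift by \<open>s\<close> inside
  the modulus is absorbed by the reverse triangle inequality. The matrix that remains is the one whose
  spectral radius controls the iteration.\<close>

lemma modulus_step_difference_le:
  fixes G L K :: "real ^ 'n ^ 'n"
  shows "\<bar>G *v (L *v x + \<bar>K *v x + s\<bar> - s) - G *v (L *v y + \<bar>K *v y + s\<bar> - s)\<bar>
    \<le> (\<bar>G\<bar> ** (\<bar>L\<bar> + \<bar>K\<bar>)) *v \<bar>x - y\<bar>"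
proof -
  define d where "d = L *v (x - y) + (\<bar>K *v x + s\<bar> - \<bar>K *v y + s\<bar>)"
  have "\<bar>d\<bar> $ i \<le> ((\<bar>L\<bar> + \<bar>K\<bar>) *v \<bar>x - y\<bar>) $ i" for i
  proof -
    have "\<bar>d\<bar> $ i \<le> \<bar>L *v (x - y)\<bar> $ i + \<bar>K *v (x - y)\<bar> $ i"
      by (simp add: d_def abs_vec_nth matrix_vector_mult_diff_distrib)
    also have "\<dots> \<le> (\<bar>L\<bar> *v \<bar>x - y\<bar>) $ i + (\<bar>K\<bar> *v \<bar>x - y\<bar>) $ i"
      using abs_matrix_vector_mult_le[of L "x - y"] abs_matrix_vector_mult_le[of K "x - y"]
      by (intro add_mono) (simp_all add: less_eq_vec_def)
    finally show ?thesis
      by (simp add: matrix_vector_mult_add_rdistrib)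
  qed
  then have d_le: "\<bar>d\<bar> \<le> (\<bar>L\<bar> + \<bar>K\<bar>) *v \<bar>x - y\<bar>"
    by (simp add: less_eq_vec_def)
  have "(L *v x + \<bar>K *v x + s\<bar> - s) - (L *v y + \<bar>K *v y + s\<bar> - s) = d"
    by (simp add: d_def matrix_vector_mult_diff_distrib)
  then have "G *v (L *v x + \<bar>K *v x + s\<bar> - s) - G *v (L *v y + \<bar>K *v y + s\<bar> - s) = G *v d"
    by (simp flip: matrix_vector_mult_diff_distrib)
  then have "\<bar>G *v (L *v x + \<bar>K *v x + s\<bar> - s) - G *v (L *v y + \<bar>K *v y + s\<bar> - s)\<bar>
    \<le> \<bar>G\<bar> *v \<bar>d\<bar>"
    using abs_matrix_vector_mult_le[of G d] by simp
  also have "\<dots> \<le> \<bar>G\<bar> *v ((\<bar>L\<bar> + \<bar>K\<bar>) *v \<bar>x - y\<bar>)"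
    by (intro nonneg_matrix_vector_mult_mono d_le) (simp add: less_eq_vec_def abs_matrix_nth)
  finally show ?thesis
    by (simp add: matrix_vector_mul_assoc)
qed

section \<open>Convergence of the iteration\<close>

theorem theorem4p1:
  fixes A M N :: "real ^ 'n ^ 'n"
    and \<sigma> \<zeta>star \<zeta>0 :: "real ^ 'n"
    and \<zeta> :: "nat \<Rightarrow> real ^ 'n"
  assumes "P_matrix A"
    and "A = (M + mat 1 + diag_part A) - (N + mat 1 + diag_part A)"
    and "invertible (M + 2 *\<^sub>R mat 1 + diag_part A)"
    and "\<zeta>star = matrix_inv (M + 2 *\<^sub>R mat 1 + diag_part A) *v
           ((N + mat 1 + diag_part A) *v \<zeta>star + \<bar>(A - mat 1) *v \<zeta>star + \<sigma>\<bar> - \<sigma>)"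
    and "spectral_radius (\<bar>matrix_inv (M + 2 *\<^sub>R mat 1 + diag_part A)\<bar> **
           (\<bar>N + mat 1 + diag_part A\<bar> + \<bar>A - mat 1\<bar>)) < 1"
    and "\<zeta> 0 = (\<chi> i. max 0 (\<zeta>0 $ i))"
    and "\<And>\<eta>. \<zeta> (Suc \<eta>) = matrix_inv (M + 2 *\<^sub>R mat 1 + diag_part A) *v
           ((N + mat 1 + diag_part A) *v \<zeta> \<eta> + \<bar>(A - mat 1) *v \<zeta> \<eta> + \<sigma>\<bar> - \<sigma>)"
  shows "\<zeta> \<longlonglongrightarrow> \<zeta>star"
proof -
  define G where "G = matrix_inv (M + 2 *\<^sub>R mat 1 + diag_part A)"
  define L where "L = N + mat 1 + diag_part A"
  define K where "K = A - mat 1"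
  define T where "T = \<bar>G\<bar> ** (\<bar>L\<bar> + \<bar>K\<bar>)"
  have fixed_point: "\<zeta>star = G *v (L *v \<zeta>star + \<bar>K *v \<zeta>star + \<sigma>\<bar> - \<sigma>)"
    using assms(4) unfolding G_def L_def K_def .
  have recurrence: "\<zeta> (Suc k) = G *v (L *v \<zeta> k + \<bar>K *v \<zeta> k + \<sigma>\<bar> - \<sigma>)" for k
    using assms(7) unfolding G_def L_def K_def .
  have "\<bar>\<zeta> (Suc k) - \<zeta>star\<bar> \<le> T *v \<bar>\<zeta> k - \<zeta>star\<bar>" for k
    using modulus_step_difference_le[of G L "\<zeta> k" K \<sigma> \<zeta>star]
    unfolding recurrence T_def fixed_point[symmetric] .
  moreover have "0 \<le> T"
    by (auto simp: T_def less_eq_vec_def matrix_matrix_mult_def abs_matrix_nth intro!: sum_nonneg)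
  moreover have "spectral_radius T < 1"
    using assms(5) unfolding T_def G_def L_def K_def .
  ultimately have "(\<lambda>k. \<zeta> k - \<zeta>star) \<longlonglongrightarrow> 0"
    using dominated_by_iterates_tendsto_0[of T "\<lambda>k. \<zeta> k - \<zeta>star"] by simp
  then show ?thesis
    by (simp add: LIM_zero_iff)
qed

end
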